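(* Let $(\Omega,\mathcal{F},\Pr)$ be a probability space, let $(\mathsf{X},\mathcal{X})$ and $(\mathsf{Y},\mathcal{Y})$ be arbitrary measurable spaces, and let $(X,Y):\Omega\to\mathsf{X}\times\mathsf{Y}$ be a pair of random variables. Then the following conditions are equivalent: 1. $X$ and $Y$ have a joint density with respect to a product measure $\mu\times\nu$, for some measures $\mu:\mathcal{X}\to[0,\infty]$ and $\nu:\mathcal{Y}\to[0,\infty]$ (arbitrary, not necessarily $\sigma$-finite). 2. $P_{X,Y}\ll P_X\times P_Y$. 3. $X$ has a conditional density $p(x\mid y)$ given $Y$ with respect to some $\sigma$-finite measure $\mu$ on $\mathcal{X}$. 4. $X$ has a conditional distribution $P_{X\mid Y}$ given $Y$ such that $P_{X\mid y}\ll P_X$ for all $y\in\mathsf{Y}$. 5. $X$ has a conditional distribution $P_{X\mid Y}$ given $Y$ and a marginal density $p(x)$ with respect to some measure $\mu$ on $\mathcal{X}$ (not necessarily $\sigma$-finite) such that $P_{X\mid y}\ll\mu$ for all $y\in\mathsf{Y}$. The same conditions with the roles of $X$ and $Y$ reversed are also equivalent to these. Furthermore: 6. If $P_{X,Y}\ll P_X\times P_Y$ (equivalently, if any one of the equivalent conditions 1–5 of this theorem holds for $X$ and $Y$), then $P_{X',Y'}\ll P_{X'}\times P_{Y'}$ (equivalently, all of conditions 1–5 hold with $X',Y'$ in place of $X,Y$) for $X'=F(X)$ and $Y'=G(Y)$, where $F:\mathsf{X}\to\mathsf{X}'$ and $G:\mathsf{Y}\to\mathsf{Y}'$ are any measurable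 functions into any measurable spaces $(\mathsf{X}',\mathcal{X}')$ and $(\mathsf{Y}',\mathcal{Y}')$.
   Context: A random variable is a measurable map from the probability space $(\Omega,\mathcal{F},\Pr)$ to some measurable space. The distribution of $X:\Omega\to\mathsf{X}$ is the measure $P_X(S)=\Pr(X^{-1}(S))$, $S\in\mathcal{X}$; $P_{X,Y}$ is the distribution of $(X,Y)$ on $\mathcal{X}\otimes\mathcal{Y}$, the $\sigma$-algebra generated by all measurable rectangles. Density: a measurable function $p:\mathsf{X}\to[0,\infty]$ is a density of $X$ with respect to a measure $\mu:\mathcal{X}\to[0,\infty]$ if $P_X(S)=\int_S p\,d\mu$ for all $S\in\mathcal{X}$. A joint density of $X$ and $Y$ is a density of $(X,Y)$; a marginal density of $X$ is a density of $X$. Product of arbitrary measures: for arbitrary measures $\mu:\mathcal{X}\to[0,\infty]$ and $\nu:\mathcal{Y}\to[0,\infty]$, the measure $\mu\times\nu:\mathcal{X}\otimes\mathcal{Y}\to[0,\infty]$ is defined by $$(\mu\times\nu)(S)=\inf\Big\{\sum_{k=1}^\infty\mu(A_k)\nu(B_k): A_k\in\mathcal{X},\ B_k\in\mathcal{Y},\ S\subset\bigcup_{k=1}^\infty A_k\times B_k\Big\},$$ with the usual convention $0\cdot\infty=0$. Transition measure: a function $\kappa:\mathsf{Y}\times\mathcal{X}\to[0,\infty]$ such that $S\mapsto\kappa(y,S)$ is a measure on $\mathcal{X}$ for every $y\in\mathsf{Y}$ and $y\mapsto\kappa(y,S)$ is $\mathcal{Y}$-measurable for every $S\in\mathcal{X}$.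 Its product with a $\sigma$-finite measure $\nu$ on $\mathcal{Y}$ is $(\kappa\times\nu)(S)=\int\kappa(y,S_y)\,d\nu(y)$ for $S\in\mathcal{X}\otimes\mathcal{Y}$, where $S_y=\{x:(x,y)\in S\}$. Conditional distribution: a transition measure $P_{X\mid Y}:\mathsf{Y}\times\mathcal{X}\to[0,\infty]$ with $P_{X,Y}=P_{X\mid Y}\times P_Y$ is called a conditional distribution of $X$ given $Y$; write $P_{X\mid y}=P_{X\mid Y}(y,\cdot)$. (Existence is not automatic in arbitrary measurable spaces.) Conditional density: a jointly measurable nonnegative (possibly extended-valued) function $(x,y)\mapsto p(x\mid y)$ is a conditional density of $X$ given $Y$ with respect to a measure $\mu$ on $\mathcal{X}$ if there is a conditional distribution $P_{X\mid Y}$ with $P_{X\mid y}(S)=\int_S p(x\mid y)\,d\mu(x)$ for all $S\in\mathcal{X}$ and all $y\in\mathsf{Y}$. *)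

theory Defs
  imports "HOL-Probability.Probability"
begin

text \<open>
  A measurable space is represented by a measure of which only the space and the \<sigma>-algebra are
  used; a measure on that measurable space is then a measure with the same sets.
\<close>

section \<open>The product of two arbitrary measures\<close>

definition rectangle_outer :: "'a measure \<Rightarrow> 'b measure \<Rightarrow> ('a \<times> 'b) set \<Rightarrow> ennreal" where
  "rectangle_outer \<mu> \<nu> S =
     (INF (A, B) \<in> {(A, B). range A \<subseteq> sets \<mu> \<and> range B \<subseteq> sets \<nu> \<and> S \<subseteq> (\<Union>k::nat. A k \<times> B k)}.
        \<Sum>k. emeasure \<mu> (A k) * emeasure \<nu> (B k))"

text \<open>
  The library product \<open>\<Otimes>\<^sub>M\<close> is an iterated integral, which is the product measure
  only in the \<sigma>-finite case. It is used here only for its \<sigma>-algebra. See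
  \<open>emeasure_prod_measure\<close> and \<open>prod_measure_eq_pair_measure\<close> below.
\<close>

definition prod_measure :: "'a measure \<Rightarrow> 'b measure \<Rightarrow> ('a \<times> 'b) measure"  (infixr \<open>\<times>\<^sub>M\<close> 80) where
  "\<mu> \<times>\<^sub>M \<nu> = measure_of (space \<mu> \<times> space \<nu>) (sets (\<mu> \<Otimes>\<^sub>M \<nu>)) (rectangle_outer \<mu> \<nu>)"

lemma sets_prod_measure [simp, measurable_cong]: "sets (\<mu> \<times>\<^sub>M \<nu>) = sets (\<mu> \<Otimes>\<^sub>M \<nu>)"
  unfolding prod_measure_def
  by (metis sets.sets_measure_of_eq space_pair_measure)

lemma space_prod_measure [simp]: "space (\<mu> \<times>\<^sub>M \<nu>) = space \<mu> \<times> space \<nu>"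
  by (metis sets_eq_imp_space_eq sets_prod_measure space_pair_measure)

lemma rectangle_outer_le:
  assumes "range A \<subseteq> sets \<mu>" "range B \<subseteq> sets \<nu>" "S \<subseteq> (\<Union>k::nat. A k \<times> B k)"
  shows "rectangle_outer \<mu> \<nu> S \<le> (\<Sum>k. emeasure \<mu> (A k) * emeasure \<nu> (B k))"
  unfolding rectangle_outer_def
  by (rule INF_lower2[of "(A, B)"]) (use assms in auto)

lemma rectangle_outer_close:
  assumes "rectangle_outer \<mu> \<nu> S < e"
  obtains A B where "range A \<subseteq> sets \<mu>" "range B \<subseteq> sets \<nu>" "S \<subseteq> (\<Union>k::nat. A k \<times> B k)"
    "(\<Sum>k. emeasure \<mu> (A k) * emeasure \<nu> (B k)) < e"
  using assms unfolding rectangle_outer_def INF_less_iff by auto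

lemma rectangle_outer_empty: "rectangle_outer \<mu> \<nu> {} = 0"
proof -
  have "rectangle_outer \<mu> \<nu> {} \<le> (\<Sum>k::nat. emeasure \<mu> {} * emeasure \<nu> {})"
    by (rule rectangle_outer_le) auto
  then show ?thesis by simp
qed

lemma rectangle_outer_space: "outer_measure_space (Pow \<Omega>) (rectangle_outer \<mu> \<nu>)"
  unfolding outer_measure_space_def
proof (intro conjI)
  show "positive (Pow \<Omega>) (rectangle_outer \<mu> \<nu>)"
    by (simp add: positive_def rectangle_outer_empty)
  show "increasing (Pow \<Omega>) (rectangle_outer \<mu> \<nu>)"
    unfolding increasing_def rectangle_outer_def
    by (intro ballI impI INF_superset_mono) auto
  show "countably_subadditive (Pow \<Omega>) (rectangle_outer \<mu> \<nu>)"
    unfolding countably_subadditive_def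
  proof (intro allI impI)
    fix S :: "nat \<Rightarrow> ('a \<times> 'b) set"
    let ?O = "rectangle_outer \<mu> \<nu>"
    show "?O (\<Union>i. S i) \<le> (\<Sum>i. ?O (S i))"
    proof (rule ennreal_le_epsilon)
      fix e :: real assume e: "0 < e" and fin: "(\<Sum>i. ?O (S i)) < top"
      have lt: "?O (S n) < ?O (S n) + e * (1/2)^Suc n" for n
        using e fin by (auto simp add: less_top dest!: ennreal_suminf_lessD)
      define cover where "cover n A B \<longleftrightarrow> range A \<subseteq> sets \<mu> \<and> range B \<subseteq> sets \<nu> \<and>
          S n \<subseteq> (\<Union>k::nat. A k \<times> B k) \<and>
          (\<Sum>k. emeasure \<mu> (A k) * emeasure \<nu> (B k)) \<le> ?O (S n) + e * (1/2)^Suc n" for n A B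
      have "\<exists>A B. cover n A B" for n
        unfolding cover_def by (rule rectangle_outer_close[OF lt[of n]]) (blast intro: less_imp_le)
      then obtain A B where "\<And>n. cover n (A n) (B n)"
        by metis
      then have AB: "\<And>n. range (A n) \<subseteq> sets \<mu>" "\<And>n. range (B n) \<subseteq> sets \<nu>"
          "\<And>n. S n \<subseteq> (\<Union>k::nat. A n k \<times> B n k)"
          "\<And>n. (\<Sum>k. emeasure \<mu> (A n k) * emeasure \<nu> (B n k)) \<le> ?O (S n) + e * (1/2)^Suc n"
        unfolding cover_def by blast+
      define C where "C = (\<lambda>k. case prod_decode k of (n, i) \<Rightarrow> A n i)"
      define D where "D = (\<lambda>k. case prod_decode k of (n, i) \<Rightarrow> B n i)"
      have "?O (\<Union>i. S i) \<le> (\<Sum>k. emeasure \<mu> (C k) * emeasure \<nu> (D k))"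
      proof (rule rectangle_outer_le)
        show "range C \<subseteq> sets \<mu>" "range D \<subseteq> sets \<nu>"
          using AB(1,2) by (auto simp: C_def D_def split: prod.split)
        show "(\<Union>i. S i) \<subseteq> (\<Union>k. C k \<times> D k)"
        proof
          fix z assume "z \<in> (\<Union>i. S i)"
          then obtain n where "z \<in> S n" by blast
          with AB(3)[of n] obtain i where "z \<in> A n i \<times> B n i" by blast
          then have "z \<in> C (prod_encode (n, i)) \<times> D (prod_encode (n, i))"
            by (simp add: C_def D_def)
          then show "z \<in> (\<Union>k. C k \<times> D k)" by blast
        qed
      qed
      also have "\<dots> = (\<Sum>n. \<Sum>i. emeasure \<mu> (A n i) * emeasure \<nu> (B n i))"
      proof -
        have "(\<lambda>k. emeasure \<mu> (C k) * emeasure \<nu> (D k)) =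
            (\<lambda>(n, i). emeasure \<mu> (A n i) * emeasure \<nu> (B n i)) \<circ> prod_decode"
          by (auto simp: C_def D_def split: prod.split)
        then show ?thesis
          by (simp only: comp_def) (intro suminf_ennreal_2dimen, simp)
      qed
      also have "\<dots> \<le> (\<Sum>n. ?O (S n) + e * (1/2)^Suc n)"
        by (intro suminf_le AB(4)) auto
      also have "\<dots> = (\<Sum>n. ?O (S n)) + (\<Sum>n. ennreal e * ennreal ((1/2)^Suc n))"
        using e by (subst suminf_add[symmetric])
          (auto simp del: ennreal_suminf_cmult simp add: ennreal_mult[symmetric])
      also have "\<dots> = (\<Sum>n. ?O (S n)) + e"
        unfolding ennreal_suminf_cmult
        by (subst suminf_ennreal_eq[OF zero_le_power power_half_series]) auto
      finally show "?O (\<Union>i. S i) \<le> (\<Sum>i. ?O (S i)) + e" .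
    qed
  qed
qed

lemma rectangle_outer_lambda:
  assumes P: "P \<in> sets \<mu>" and Q: "Q \<in> sets \<nu>" and PQ: "P = space \<mu> \<or> Q = space \<nu>"
  shows "P \<times> Q \<in> lambda_system (space \<mu> \<times> space \<nu>) (Pow (space \<mu> \<times> space \<nu>)) (rectangle_outer \<mu> \<nu>)"
proof -
  let ?O = "rectangle_outer \<mu> \<nu>" and ?\<Omega> = "space \<mu> \<times> space \<nu>"
  define P' Q' where "P' = (if Q = space \<nu> then space \<mu> - P else space \<mu>)"
    and "Q' = (if Q = space \<nu> then space \<nu> else space \<nu> - Q)"
  have P': "P' \<in> sets \<mu>" and Q': "Q' \<in> sets \<nu>" using P Q by (auto simp: P'_def Q'_def)
  have compl: "?\<Omega> - P \<times> Q = P' \<times> Q'"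
    using PQ by (auto simp: P'_def Q'_def)
  have split: "emeasure \<mu> (A \<inter> P) * emeasure \<nu> (B \<inter> Q) + emeasure \<mu> (A \<inter> P') * emeasure \<nu> (B \<inter> Q')
      = emeasure \<mu> A * emeasure \<nu> B" if A: "A \<in> sets \<mu>" and B: "B \<in> sets \<nu>" for A B
  proof (cases "Q = space \<nu>")
    case True
    have "emeasure \<mu> (A \<inter> P) + emeasure \<mu> (A \<inter> P') = emeasure \<mu> A"
      using A P P' True sets.sets_into_space[OF A]
      by (subst plus_emeasure) (auto simp: P'_def intro!: arg_cong[where f = "emeasure \<mu>"])
    moreover have "B \<inter> Q = B" "B \<inter> Q' = B"
      using True sets.sets_into_space[OF B] by (auto simp: Q'_def)
    ultimately show ?thesis by (simp flip: distrib_right)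
  next
    case False
    have "emeasure \<nu> (B \<inter> Q) + emeasure \<nu> (B \<inter> Q') = emeasure \<nu> B"
      using B Q Q' False sets.sets_into_space[OF B]
      by (subst plus_emeasure) (auto simp: Q'_def intro!: arg_cong[where f = "emeasure \<nu>"])
    moreover have "A \<inter> P = A" "A \<inter> P' = A"
      using False PQ sets.sets_into_space[OF A] by (auto simp: P'_def)
    ultimately show ?thesis by (simp flip: distrib_left)
  qed
  interpret O: sigma_algebra ?\<Omega> "Pow ?\<Omega>" by (rule sigma_algebra_Pow)
  note oms = rectangle_outer_space[of ?\<Omega> \<mu> \<nu>]
  have "?O (P \<times> Q \<inter> S) + ?O ((?\<Omega> - P \<times> Q) \<inter> S) = ?O S" if S: "S \<in> Pow ?\<Omega>" for S
  proof (rule antisym)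
    show "?O (P \<times> Q \<inter> S) + ?O ((?\<Omega> - P \<times> Q) \<inter> S) \<le> ?O S"
      unfolding compl rectangle_outer_def[of \<mu> \<nu> S]
    proof (rule INF_greatest, clarsimp)
      fix A :: "nat \<Rightarrow> 'a set" and B :: "nat \<Rightarrow> 'b set"
      assume A: "range A \<subseteq> sets \<mu>" and B: "range B \<subseteq> sets \<nu>" and c: "S \<subseteq> (\<Union>k. A k \<times> B k)"
      have "?O (P \<times> Q \<inter> S) \<le> (\<Sum>k. emeasure \<mu> (A k \<inter> P) * emeasure \<nu> (B k \<inter> Q))"
        by (rule rectangle_outer_le) (use A B P Q c in auto)
      moreover have "?O (P' \<times> Q' \<inter> S) \<le> (\<Sum>k. emeasure \<mu> (A k \<inter> P') * emeasure \<nu> (B k \<inter> Q'))"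
        by (rule rectangle_outer_le) (use A B P' Q' c in auto)
      ultimately have "?O (P \<times> Q \<inter> S) + ?O (P' \<times> Q' \<inter> S) \<le>
          (\<Sum>k. emeasure \<mu> (A k \<inter> P) * emeasure \<nu> (B k \<inter> Q)) + (\<Sum>k. emeasure \<mu> (A k \<inter> P') * emeasure \<nu> (B k \<inter> Q'))"
        by (rule add_mono)
      also have "\<dots> = (\<Sum>k. emeasure \<mu> (A k) * emeasure \<nu> (B k))"
        using A B by (subst suminf_add) (auto intro!: suminf_cong split)
      finally show "?O (P \<times> Q \<inter> S) + ?O (P' \<times> Q' \<inter> S) \<le> (\<Sum>k. emeasure \<mu> (A k) * emeasure \<nu> (B k))" .
    qed
  next
    have "subadditive (Pow ?\<Omega>) ?O"
      using oms unfolding outer_measure_space_def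
      by (intro O.countably_subadditive_subadditive) auto
    then have "?O ((P \<times> Q \<inter> S) \<union> ((?\<Omega> - P \<times> Q) \<inter> S)) \<le> ?O (P \<times> Q \<inter> S) + ?O ((?\<Omega> - P \<times> Q) \<inter> S)"
      using S by (intro subadditiveD) auto
    moreover have "(P \<times> Q \<inter> S) \<union> ((?\<Omega> - P \<times> Q) \<inter> S) = S" using S by auto
    ultimately show "?O S \<le> ?O (P \<times> Q \<inter> S) + ?O ((?\<Omega> - P \<times> Q) \<inter> S)" by simp
  qed
  moreover have "P \<times> Q \<subseteq> ?\<Omega>"
    using sets.sets_into_space[OF P] sets.sets_into_space[OF Q] by auto
  ultimately show ?thesis by (auto simp: lambda_system_def)
qed

theorem emeasure_prod_measure:
  assumes "S \<in> sets (\<mu> \<Otimes>\<^sub>M \<nu>)"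
  shows "emeasure (\<mu> \<times>\<^sub>M \<nu>) S = rectangle_outer \<mu> \<nu> S"
proof -
  let ?O = "rectangle_outer \<mu> \<nu>" and ?\<Omega> = "space \<mu> \<times> space \<nu>"
  let ?L = "lambda_system ?\<Omega> (Pow ?\<Omega>) ?O"
  interpret O: sigma_algebra ?\<Omega> "Pow ?\<Omega>" by (rule sigma_algebra_Pow)
  have L: "measure_space ?\<Omega> ?L ?O"
    by (rule O.caratheodory_lemma[OF rectangle_outer_space])
  then interpret L: sigma_algebra ?\<Omega> ?L by (simp add: measure_space_def)
  have "P \<times> Q \<in> ?L" if P: "P \<in> sets \<mu>" and Q: "Q \<in> sets \<nu>" for P Q
  proof -
    have "(P \<times> space \<nu>) \<inter> (space \<mu> \<times> Q) \<in> ?L"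
      using P Q by (intro L.Int rectangle_outer_lambda) auto
    moreover have "(P \<times> space \<nu>) \<inter> (space \<mu> \<times> Q) = P \<times> Q"
      using sets.sets_into_space[OF P] sets.sets_into_space[OF Q] by auto
    ultimately show ?thesis by simp
  qed
  then have sub: "sets (\<mu> \<Otimes>\<^sub>M \<nu>) \<subseteq> ?L"
    unfolding sets_pair_measure by (intro L.sigma_sets_subset) auto
  have "countably_additive (sets (\<mu> \<Otimes>\<^sub>M \<nu>)) ?O"
    using L sub unfolding measure_space_def countably_additive_def by blast
  moreover have "sets (\<mu> \<Otimes>\<^sub>M \<nu>) \<subseteq> Pow ?\<Omega>"
    using sets.space_closed[of "\<mu> \<Otimes>\<^sub>M \<nu>"] by (simp add: space_pair_measure)
  ultimately show ?thesis
    using assms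
    by (intro emeasure_measure_of[OF prod_measure_def]) (auto simp: positive_def rectangle_outer_empty)
qed

lemma rectangle_outer_times:
  assumes A: "A \<in> sets \<mu>" and B: "B \<in> sets \<nu>"
  shows "rectangle_outer \<mu> \<nu> (A \<times> B) = emeasure \<mu> A * emeasure \<nu> B"
proof (rule antisym)
  let ?A = "\<lambda>k::nat. if k = 0 then A else {}" and ?B = "\<lambda>k::nat. if k = 0 then B else {}"
  have "rectangle_outer \<mu> \<nu> (A \<times> B) \<le> (\<Sum>k. emeasure \<mu> (?A k) * emeasure \<nu> (?B k))"
    by (rule rectangle_outer_le) (use A B in \<open>auto intro!: exI[of _ 0]\<close>)
  also have "\<dots> = emeasure \<mu> A * emeasure \<nu> B"
    by (subst suminf_finite[of "{0}"]) auto
  finally show "rectangle_outer \<mu> \<nu> (A \<times> B) \<le> emeasure \<mu> A * emeasure \<nu> B" .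
next
  show "emeasure \<mu> A * emeasure \<nu> B \<le> rectangle_outer \<mu> \<nu> (A \<times> B)"
    unfolding rectangle_outer_def
  proof (rule INF_greatest, clarsimp)
    fix C :: "nat \<Rightarrow> 'a set" and D :: "nat \<Rightarrow> 'b set"
    assume C: "range C \<subseteq> sets \<mu>" and D: "range D \<subseteq> sets \<nu>" and c: "A \<times> B \<subseteq> (\<Union>k. C k \<times> D k)"
    have *: "emeasure \<nu> B * indicator A x \<le> (\<Sum>k. emeasure \<nu> (D k) * indicator (C k) x)" for x
    proof (cases "x \<in> A")
      case True
      let ?E = "\<lambda>k. if x \<in> C k then D k else {}"
      have "emeasure \<nu> B \<le> emeasure \<nu> (\<Union>k. ?E k)"
      proof (intro emeasure_mono)
        show "B \<subseteq> (\<Union>k. ?E k)"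
        proof
          fix b assume "b \<in> B"
          with c True obtain k where "x \<in> C k" "b \<in> D k" by blast
          then show "b \<in> (\<Union>k. ?E k)" by (intro UN_I[of k]) simp_all
        qed
        show "(\<Union>k. ?E k) \<in> sets \<nu>"
          using D by (intro sets.countable_UN) auto
      qed
      also have "\<dots> \<le> (\<Sum>k. emeasure \<nu> (?E k))"
        using D by (intro emeasure_subadditive_countably) auto
      also have "\<dots> = (\<Sum>k. emeasure \<nu> (D k) * indicator (C k) x)"
        by (intro suminf_cong) auto
      finally show ?thesis using True by simp
    qed simp
    have "emeasure \<mu> A * emeasure \<nu> B = (\<integral>\<^sup>+ x. emeasure \<nu> B * indicator A x \<partial>\<mu>)"
      using A by (subst nn_integral_cmult_indicator) (auto simp: mult.commute)
    also have "\<dots> \<le> (\<integral>\<^sup>+ x. (\<Sum>k. emeasure \<nu> (D k) * indicator (C k) x) \<partial>\<mu>)"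
      by (intro nn_integral_mono *)
    also have "\<dots> = (\<Sum>k. \<integral>\<^sup>+ x. emeasure \<nu> (D k) * indicator (C k) x \<partial>\<mu>)"
      using C by (intro nn_integral_suminf) auto
    also have "\<dots> = (\<Sum>k. emeasure \<mu> (C k) * emeasure \<nu> (D k))"
      using C by (intro suminf_cong, subst nn_integral_cmult_indicator) (auto simp: mult.commute)
    finally show "emeasure \<mu> A * emeasure \<nu> B \<le> (\<Sum>k. emeasure \<mu> (C k) * emeasure \<nu> (D k))" .
  qed
qed

theorem prod_measure_eq_pair_measure:
  assumes "sigma_finite_measure \<mu>" "sigma_finite_measure \<nu>"
  shows "\<mu> \<times>\<^sub>M \<nu> = \<mu> \<Otimes>\<^sub>M \<nu>"
  using assms
  by (intro pair_measure_eqI[symmetric])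
     (auto simp: emeasure_prod_measure rectangle_outer_times)


section \<open>Conditional distributions and densities\<close>

definition transition_measure :: "'x measure \<Rightarrow> 'y measure \<Rightarrow> ('y \<Rightarrow> 'x measure) \<Rightarrow> bool" where
  "transition_measure MX MY \<kappa> \<longleftrightarrow>
     (\<forall>y\<in>space MY. sets (\<kappa> y) = sets MX) \<and>
     (\<forall>S\<in>sets MX. (\<lambda>y. emeasure (\<kappa> y) S) \<in> borel_measurable MY)"

definition transition_product :: "('y \<Rightarrow> 'x measure) \<Rightarrow> 'y measure \<Rightarrow> ('x \<times> 'y) set \<Rightarrow> ennreal" where
  "transition_product \<kappa> \<nu> S = (\<integral>\<^sup>+ y. emeasure (\<kappa> y) {x. (x, y) \<in> S} \<partial>\<nu>)"

text \<open>
  The values of \<open>\<kappa>\<close> off \<open>space MY\<close> are irrelevant, and \<open>\<kappa> y\<close> need not be a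
  probability measure. A conditional distribution has total mass 1 at almost every \<open>y\<close>, so the
  integrand of \<open>transition_product\<close> is then measurable up to a null set, on which the
  nonnegative integral is not affected.
\<close>

definition conditional_distribution ::
    "'w measure \<Rightarrow> 'x measure \<Rightarrow> 'y measure \<Rightarrow> ('w \<Rightarrow> 'x) \<Rightarrow> ('w \<Rightarrow> 'y) \<Rightarrow> ('y \<Rightarrow> 'x measure) \<Rightarrow> bool" where
  "conditional_distribution M MX MY X Y \<kappa> \<longleftrightarrow>
     transition_measure MX MY \<kappa> \<and>
     (\<forall>S\<in>sets (MX \<Otimes>\<^sub>M MY).
        emeasure (distr M (MX \<Otimes>\<^sub>M MY) (\<lambda>\<omega>. (X \<omega>, Y \<omega>))) S = transition_product \<kappa> (distr M MY Y) S)"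

definition conditional_density ::
    "'w measure \<Rightarrow> 'x measure \<Rightarrow> 'y measure \<Rightarrow> ('w \<Rightarrow> 'x) \<Rightarrow> ('w \<Rightarrow> 'y) \<Rightarrow> 'x measure \<Rightarrow> ('x \<Rightarrow> 'y \<Rightarrow> ennreal) \<Rightarrow> bool"
  where
  "conditional_density M MX MY X Y \<mu> p \<longleftrightarrow>
     sets \<mu> = sets MX \<and>
     (\<lambda>(x, y). p x y) \<in> borel_measurable (MX \<Otimes>\<^sub>M MY) \<and>
     (\<exists>\<kappa>. conditional_distribution M MX MY X Y \<kappa> \<and>
        (\<forall>S\<in>sets MX. \<forall>y\<in>space MY. emeasure (\<kappa> y) S = (\<integral>\<^sup>+ x\<in>S. p x y \<partial>\<mu>)))"


section \<open>The equivalent conditions\<close>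

text \<open>
  The library's \<open>absolutely_continuous N P\<close> is \<open>P \<lless> N\<close> (the dominating measure
  comes first), and \<open>distributed M \<mu> X p\<close> says that \<open>p\<close> is a density of \<open>X\<close> with
  respect to \<open>\<mu>\<close>.
\<close>

definition has_joint_density ::
    "'w measure \<Rightarrow> 'x measure \<Rightarrow> 'y measure \<Rightarrow> ('w \<Rightarrow> 'x) \<Rightarrow> ('w \<Rightarrow> 'y) \<Rightarrow> bool" where
  "has_joint_density M MX MY X Y \<longleftrightarrow>
     (\<exists>\<mu> \<nu> p. sets \<mu> = sets MX \<and> sets \<nu> = sets MY \<and>
        distributed M (\<mu> \<times>\<^sub>M \<nu>) (\<lambda>\<omega>. (X \<omega>, Y \<omega>)) p)"

definition joint_abs_cont ::
    "'w measure \<Rightarrow> 'x measure \<Rightarrow> 'y measure \<Rightarrow> ('w \<Rightarrow> 'x) \<Rightarrow> ('w \<Rightarrow> 'y) \<Rightarrow> bool" where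
  "joint_abs_cont M MX MY X Y \<longleftrightarrow>
     absolutely_continuous (distr M MX X \<times>\<^sub>M distr M MY Y)
       (distr M (MX \<Otimes>\<^sub>M MY) (\<lambda>\<omega>. (X \<omega>, Y \<omega>)))"

definition has_conditional_density ::
    "'w measure \<Rightarrow> 'x measure \<Rightarrow> 'y measure \<Rightarrow> ('w \<Rightarrow> 'x) \<Rightarrow> ('w \<Rightarrow> 'y) \<Rightarrow> bool" where
  "has_conditional_density M MX MY X Y \<longleftrightarrow>
     (\<exists>\<mu> p. sigma_finite_measure \<mu> \<and> conditional_density M MX MY X Y \<mu> p)"

definition conditional_abs_cont ::
    "'w measure \<Rightarrow> 'x measure \<Rightarrow> 'y measure \<Rightarrow> ('w \<Rightarrow> 'x) \<Rightarrow> ('w \<Rightarrow> 'y) \<Rightarrow> bool" where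
  "conditional_abs_cont M MX MY X Y \<longleftrightarrow>
     (\<exists>\<kappa>. conditional_distribution M MX MY X Y \<kappa> \<and>
        (\<forall>y\<in>space MY. absolutely_continuous (distr M MX X) (\<kappa> y)))"

definition conditional_abs_cont_marginal ::
    "'w measure \<Rightarrow> 'x measure \<Rightarrow> 'y measure \<Rightarrow> ('w \<Rightarrow> 'x) \<Rightarrow> ('w \<Rightarrow> 'y) \<Rightarrow> bool" where
  "conditional_abs_cont_marginal M MX MY X Y \<longleftrightarrow>
     (\<exists>\<kappa> \<mu> p. conditional_distribution M MX MY X Y \<kappa> \<and>
        sets \<mu> = sets MX \<and> distributed M \<mu> X p \<and>
        (\<forall>y\<in>space MY. absolutely_continuous \<mu> (\<kappa> y)))"

end

theory Submission
  imports Defs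
begin

text \<open>
  Absolute continuity of the joint law with respect to the product of the marginal laws is the
  hub of the equivalence. For probability measures the product measure is the familiar
  \<open>\<Otimes>\<^sub>M\<close>, so Radon--Nikodym and Tonelli are available there.

  From absolute continuity, take a Radon--Nikodym density \<open>f\<close> of \<open>P\<^sub>X\<^sub>,\<^sub>Y\<close> with respect to
  \<open>P\<^sub>X \<otimes> P\<^sub>Y\<close>. This is a joint density, and \<open>P\<^sub>X\<^sub>|\<^sub>y = f(\<cdot>, y) P\<^sub>X\<close> is a conditional distribution which
  has a conditional density with respect to \<open>P\<^sub>X\<close> and hence is dominated by \<open>P\<^sub>X\<close> at every \<open>y\<close>
  (\<open>joint_abs_cont_kernel\<close>). Its mass is \<open>1\<close> at almost every \<open>y\<close>, which is all that a
  conditional distribution satisfies.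

  Conversely, both conditions on conditional densities and kernels imply the formally weakest one, a
  marginal density \<open>p\<close> with respect to some \<open>\<mu>\<close> that dominates all \<open>P\<^sub>X\<^sub>|\<^sub>y\<close>. Under it, almost every
  section \<open>S\<^sub>y\<close> of a \<open>P\<^sub>X \<otimes> P\<^sub>Y\<close>-null set \<open>S\<close> is \<open>P\<^sub>X\<close>-null, that is, \<open>\<mu>\<close>-null outside \<open>{p = 0}\<close>. Hence
  \<open>P\<^sub>X\<^sub>|\<^sub>y\<close> does not charge \<open>S\<^sub>y - {p = 0}\<close>, and for almost every \<open>y\<close> it does not charge \<open>{p = 0}\<close>
  either, since this set is \<open>P\<^sub>X\<close>-null. Integrating over \<open>y\<close> gives \<open>P\<^sub>X\<^sub>,\<^sub>Y(S) = 0\<close>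
  (\<open>joint_abs_cont_if_conditional_abs_cont_marginal\<close>).

  The delicate case is a joint density with respect to a product of arbitrary measures, where
  neither Fubini nor Radon--Nikodym applies. Here finiteness of \<open>P\<^sub>X\<^sub>,\<^sub>Y\<close> helps: the set where the
  density is positive is a countable union of sets of finite product measure, and by the definition
  of the product measure as an infimum over covers, each of these is covered by countably many
  rectangles \<open>A \<times> B\<close> with \<open>\<mu>(A) \<nu>(B) < \<infinity>\<close>. A rectangle with an infinite side then has the other
  side null, so it is null and can be discarded. What is left lives on \<open>U \<times> V\<close> with \<open>\<mu>\<close> \<open>\<sigma>\<close>-finite on
  \<open>U\<close> and \<open>\<nu>\<close> \<open>\<sigma>\<close>-finite on \<open>V\<close> (\<open>joint_abs_cont_if_has_joint_density\<close>). In the \<open>\<sigma>\<close>-finite case, the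
  product of the marginals has density \<open>q(x) r(y)\<close> with \<open>q, r\<close> the marginal densities, and the
  joint density vanishes almost everywhere that \<open>q(x) r(y) = 0\<close>
  (\<open>joint_abs_cont_if_sigma_finite\<close>).

  Both the exchange of the two variables and the passage to images of them transport the joint
  law and the product of the marginals along one and the same map, which preserves absolute
  continuity.
\<close>

section \<open>Restricting measures to \<open>\<sigma>\<close>-finite parts\<close>

lemma sigma_finite_density_indicator:
  assumes "countable \<A>" "\<A> \<subseteq> sets \<mu>" "\<And>a. a \<in> \<A> \<Longrightarrow> emeasure \<mu> a < \<infinity>"
  shows "sigma_finite_measure (density \<mu> (indicator (\<Union>\<A>)))"
proof
  have U: "\<Union>\<A> \<in> sets \<mu>"
    using assms(1,2) by (rule sets.countable_Union)
  let ?m = "density \<mu> (indicator (\<Union>\<A>))"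
  \<comment> \<open>the complement of the union, which is null, completes \<open>\<A>\<close> to a cover of the whole space\<close>
  have "emeasure ?m (space \<mu> - \<Union>\<A>) = 0"
    using U by (subst emeasure_density) (auto simp flip: indicator_inter_arith)
  moreover have "emeasure ?m a = emeasure \<mu> a" if "a \<in> \<A>" for a
  proof -
    have "\<Union>\<A> \<inter> a = a" "a \<in> sets \<mu>" using that assms(2) by auto
    then show ?thesis
      using U by (subst emeasure_density) (simp_all flip: indicator_inter_arith)
  qed
  ultimately have "emeasure ?m a \<noteq> \<infinity>" if "a \<in> insert (space \<mu> - \<Union>\<A>) \<A>" for a
    using assms(3)[of a] that by auto
  moreover have "\<Union>(insert (space \<mu> - \<Union>\<A>) \<A>) = space ?m"
    using sets.sets_into_space[OF U] by auto
  moreover have "insert (space \<mu> - \<Union>\<A>) \<A> \<subseteq> sets ?m"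
    using U assms(2) by auto
  ultimately show "\<exists>A. countable A \<and> A \<subseteq> sets ?m \<and> \<Union>A = space ?m \<and> (\<forall>a\<in>A. emeasure ?m a \<noteq> \<infinity>)"
    using assms(1) by (intro exI[of _ "insert (space \<mu> - \<Union>\<A>) \<A>"]) auto
qed

text \<open>
  Cutting the rectangles of a cover of \<open>S\<close> down to \<open>A \<times> B\<close> gives a cover of the part of \<open>S\<close> in \<open>A \<times> B\<close>
  at the cost of the original cover under the restricted measures. So a null set of the
  restricted product meets \<open>A \<times> B\<close> in a null set of the original product.
\<close>

lemma rectangle_outer_restrict_le:
  assumes A: "A \<in> sets \<mu>" and B: "B \<in> sets \<nu>"
  shows "rectangle_outer \<mu> \<nu> (S \<inter> A \<times> B) \<le>
    rectangle_outer (density \<mu> (indicator A)) (density \<nu> (indicator B)) S"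
  unfolding rectangle_outer_def[of "density \<mu> (indicator A)"]
proof (rule INF_greatest, clarsimp)
  fix C :: "nat \<Rightarrow> 'a set" and D :: "nat \<Rightarrow> 'b set"
  assume C: "range C \<subseteq> sets \<mu>" and D: "range D \<subseteq> sets \<nu>" and c: "S \<subseteq> (\<Union>k. C k \<times> D k)"
  have "emeasure (density \<mu> (indicator A)) (C k) = emeasure \<mu> (A \<inter> C k)" for k
    using A C by (subst emeasure_density) (auto simp flip: indicator_inter_arith)
  moreover have "emeasure (density \<nu> (indicator B)) (D k) = emeasure \<nu> (B \<inter> D k)" for k
    using B D by (subst emeasure_density) (auto simp flip: indicator_inter_arith)
  moreover have "rectangle_outer \<mu> \<nu> (S \<inter> A \<times> B) \<le> (\<Sum>k. emeasure \<mu> (A \<inter> C k) * emeasure \<nu> (B \<inter> D k))"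
    by (rule rectangle_outer_le) (use A B C D c in auto)
  ultimately show "rectangle_outer \<mu> \<nu> (S \<inter> A \<times> B) \<le>
      (\<Sum>k. emeasure (density \<mu> (indicator A)) (C k) * emeasure (density \<nu> (indicator B)) (D k))"
    by simp
qed

text \<open>
  The sets \<open>{p \<ge> 1/n}\<close> exhaust \<open>{p > 0}\<close> and have finite measure by Markov's inequality. Thus the
  dominating measure is \<open>\<sigma>\<close>-finite on a carrier of the finite measure, however wild it is elsewhere.
\<close>

lemma finite_density_carrier:
  assumes p: "p \<in> borel_measurable N" and fin: "emeasure (density N p) (space N) < \<infinity>"
  obtains E :: "nat \<Rightarrow> 'a set" where "range E \<subseteq> sets N" "\<And>n. emeasure N (E n) < \<infinity>"
    "space N - (\<Union>n. E n) \<in> null_sets (density N p)"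
proof
  let ?E = "\<lambda>n::nat. {z \<in> space N. 1 \<le> of_nat n * p z}"
  show E: "range ?E \<subseteq> sets N" using p by auto
  have int: "(\<integral>\<^sup>+z. p z * indicator (space N) z \<partial>N) < \<infinity>"
    using fin p by (simp add: emeasure_density)
  show "emeasure N (?E n) < \<infinity>" for n
  proof -
    have "emeasure N (?E n) \<le> of_nat n * (\<integral>\<^sup>+z. p z * indicator (space N) z \<partial>N)"
      using p by (intro nn_integral_Markov_inequality) simp_all
    also have "\<dots> < \<infinity>" using int by (simp add: ennreal_mult_less_top of_nat_less_top)
    finally show ?thesis .
  qed
  show "space N - (\<Union>n. ?E n) \<in> null_sets (density N p)"
  proof (subst null_sets_density_iff[OF p], intro conjI AE_I2 impI)
    fix z assume z: "z \<in> space N - (\<Union>n. ?E n)"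
    show "p z = 0"
    proof (rule ccontr)
      assume "p z \<noteq> 0"
      have "\<exists>n::nat. 1 < of_nat n * p z"
      proof (cases "p z = \<top>")
        case True
        then show ?thesis by (intro exI[of _ 1]) simp
      next
        case False
        then have "1 / p z < \<top>"
          using \<open>p z \<noteq> 0\<close> by (simp add: ennreal_divide_eq_top_iff flip: less_top)
        then obtain n :: nat where "1 / p z < of_nat n"
          using ennreal_Ex_less_of_nat by blast
        then show ?thesis
          using False \<open>p z \<noteq> 0\<close> by (auto simp: divide_less_ennreal less_top)
      qed
      then obtain n :: nat where "1 < of_nat n * p z" by blast
      then show False using z by (auto dest: less_imp_le)
    qed
  qed (use E in auto)
qed

section \<open>Joint and marginal laws of a random pair\<close>

locale random_pair = prob_space M for M :: "'w measure" +
  fixes MX :: "'x measure" and MY :: "'y measure" and X :: "'w \<Rightarrow> 'x" and Y :: "'w \<Rightarrow> 'y"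
  assumes X [measurable]: "X \<in> measurable M MX" and Y [measurable]: "Y \<in> measurable M MY"
begin

abbreviation PX where "PX \<equiv> distr M MX X"
abbreviation PY where "PY \<equiv> distr M MY Y"
abbreviation PXY where "PXY \<equiv> distr M (MX \<Otimes>\<^sub>M MY) (\<lambda>\<omega>. (X \<omega>, Y \<omega>))"

sublocale PX: prob_space PX by (rule prob_space_distr) simp
sublocale PY: prob_space PY by (rule prob_space_distr) simp
sublocale PXY: prob_space PXY by (rule prob_space_distr) simp
sublocale PXPY: pair_sigma_finite PX PY ..

lemma joint_abs_cont_iff:
  "joint_abs_cont M MX MY X Y \<longleftrightarrow> absolutely_continuous (PX \<Otimes>\<^sub>M PY) PXY"
  unfolding joint_abs_cont_def
  by (simp add: prod_measure_eq_pair_measure PX.sigma_finite_measure_axioms PY.sigma_finite_measure_axioms)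

lemma sets_PX_PY: "sets (PX \<Otimes>\<^sub>M PY) = sets (MX \<Otimes>\<^sub>M MY)"
  by (intro sets_pair_measure_cong) simp_all

lemma marginal_fst: "A \<in> sets MX \<Longrightarrow> emeasure PXY (A \<times> space MY) = emeasure PX A"
  using measurable_space[OF Y]
  by (subst (1 2) emeasure_distr) (auto intro!: arg_cong[where f = "emeasure M"])

lemma marginal_snd: "B \<in> sets MY \<Longrightarrow> emeasure PXY (space MX \<times> B) = emeasure PY B"
  using measurable_space[OF X]
  by (subst (1 2) emeasure_distr) (auto intro!: arg_cong[where f = "emeasure M"])

section \<open>Consequences of absolute continuity\<close>

text \<open>
  Slicing the Radon--Nikodym density: by Tonelli its sections are the densities of a transition
  measure that disintegrates the joint law. The density and the kernel are returned together since
  they serve as joint density, conditional density and conditional distribution.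
\<close>

lemma joint_abs_cont_kernel:
  assumes "joint_abs_cont M MX MY X Y"
  obtains f \<kappa> where "f \<in> borel_measurable (PX \<Otimes>\<^sub>M PY)" "density (PX \<Otimes>\<^sub>M PY) f = PXY"
    "\<kappa> = (\<lambda>y. density PX (\<lambda>x. f (x, y)))" "conditional_distribution M MX MY X Y \<kappa>"
proof -
  have "\<exists>f\<in>borel_measurable (PX \<Otimes>\<^sub>M PY). density (PX \<Otimes>\<^sub>M PY) f = PXY"
    using assms by (intro PXPY.Radon_Nikodym) (simp_all add: joint_abs_cont_iff sets_PX_PY)
  then obtain f where f: "f \<in> borel_measurable (PX \<Otimes>\<^sub>M PY)" and d: "density (PX \<Otimes>\<^sub>M PY) f = PXY"
    by blast
  define \<kappa> where "\<kappa> = (\<lambda>y. density PX (\<lambda>x. f (x, y)))"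
  have \<kappa>: "emeasure (\<kappa> y) S = (\<integral>\<^sup>+x. f (x, y) * indicator S x \<partial>PX)"
    if "y \<in> space MY" "S \<in> sets MX" for y S
    using that f unfolding \<kappa>_def by (intro emeasure_density measurable_compose[OF _ f]) auto
  have "conditional_distribution M MX MY X Y \<kappa>"
    unfolding conditional_distribution_def transition_measure_def
  proof (intro conjI ballI)
    show "sets (\<kappa> y) = sets MX" for y by (simp add: \<kappa>_def)
    fix S assume S: "S \<in> sets MX"
    have "(\<lambda>(y, x). f (x, y) * indicator S x) \<in> borel_measurable (PY \<Otimes>\<^sub>M PX)"
      using S f measurable_compose[OF measurable_pair_swap' f] by measurable
    then have "(\<lambda>y. \<integral>\<^sup>+x. f (x, y) * indicator S x \<partial>PX) \<in> borel_measurable PY"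
      by (intro PX.borel_measurable_nn_integral) simp
    then show "(\<lambda>y. emeasure (\<kappa> y) S) \<in> borel_measurable MY"
      using S by (subst measurable_cong[OF \<kappa>]) simp_all
  next
    fix S assume S: "S \<in> sets (MX \<Otimes>\<^sub>M MY)"
    then have S': "S \<in> sets (PX \<Otimes>\<^sub>M PY)" by (simp add: sets_PX_PY)
    have "emeasure PXY S = (\<integral>\<^sup>+z. f z * indicator S z \<partial>(PX \<Otimes>\<^sub>M PY))"
      unfolding d[symmetric] using f S' by (rule emeasure_density)
    also have "\<dots> = (\<integral>\<^sup>+y. \<integral>\<^sup>+x. f (x, y) * indicator S (x, y) \<partial>PX \<partial>PY)"
      using f S' by (intro PXPY.nn_integral_snd[symmetric]) simp
    also have "\<dots> = transition_product \<kappa> PY S"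
      unfolding transition_product_def
    proof (intro nn_integral_cong)
      fix y assume y: "y \<in> space PY"
      have "{x. (x, y) \<in> S} \<in> sets MX"
        using sets_Pair2[OF S, of y] by (simp add: vimage_def)
      with y show "(\<integral>\<^sup>+x. f (x, y) * indicator S (x, y) \<partial>PX) = emeasure (\<kappa> y) {x. (x, y) \<in> S}"
        by (subst \<kappa>) (auto simp: indicator_def intro!: nn_integral_cong)
    qed
    finally show "emeasure PXY S = transition_product \<kappa> PY S" .
  qed
  then show thesis using f d \<kappa>_def that by blast
qed

lemma has_joint_density_if_joint_abs_cont:
  assumes "joint_abs_cont M MX MY X Y"
  shows "has_joint_density M MX MY X Y"
proof -
  obtain f \<kappa> where f: "f \<in> borel_measurable (PX \<Otimes>\<^sub>M PY)" "density (PX \<Otimes>\<^sub>M PY) f = PXY"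
    using assms by (rule joint_abs_cont_kernel)
  have eq: "PX \<times>\<^sub>M PY = PX \<Otimes>\<^sub>M PY"
    by (intro prod_measure_eq_pair_measure PX.sigma_finite_measure_axioms PY.sigma_finite_measure_axioms)
  have "distr M (PX \<times>\<^sub>M PY) (\<lambda>\<omega>. (X \<omega>, Y \<omega>)) = PXY"
    by (intro distr_cong) (simp_all add: sets_PX_PY)
  then have "distributed M (PX \<times>\<^sub>M PY) (\<lambda>\<omega>. (X \<omega>, Y \<omega>)) f"
    using f by (simp add: distributed_def eq)
  then show ?thesis
    unfolding has_joint_density_def
    by (intro exI[of _ PX] exI[of _ PY] exI[of _ f]) simp
qed

lemma has_conditional_density_if_joint_abs_cont:
  assumes "joint_abs_cont M MX MY X Y"
  shows "has_conditional_density M MX MY X Y"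
proof -
  obtain f \<kappa> where f: "f \<in> borel_measurable (PX \<Otimes>\<^sub>M PY)"
    and \<kappa>: "\<kappa> = (\<lambda>y. density PX (\<lambda>x. f (x, y)))" "conditional_distribution M MX MY X Y \<kappa>"
    using assms by (rule joint_abs_cont_kernel)
  have "conditional_density M MX MY X Y PX (\<lambda>x y. f (x, y))"
    unfolding conditional_density_def
  proof (intro conjI exI ballI)
    show "(\<lambda>(x, y). f (x, y)) \<in> borel_measurable (MX \<Otimes>\<^sub>M MY)"
      using f by simp
    show "emeasure (\<kappa> y) S = (\<integral>\<^sup>+x\<in>S. f (x, y) \<partial>PX)" if "S \<in> sets MX" "y \<in> space MY" for S y
      using that f unfolding \<kappa>(1) by (intro emeasure_density measurable_compose[OF _ f]) auto
  qed (use \<kappa>(2) in auto)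
  then show ?thesis
    unfolding has_conditional_density_def using PX.sigma_finite_measure_axioms by blast
qed

lemma conditional_abs_cont_if_joint_abs_cont:
  assumes "joint_abs_cont M MX MY X Y"
  shows "conditional_abs_cont M MX MY X Y"
proof -
  obtain f \<kappa> where f: "f \<in> borel_measurable (PX \<Otimes>\<^sub>M PY)"
    and \<kappa>: "\<kappa> = (\<lambda>y. density PX (\<lambda>x. f (x, y)))" "conditional_distribution M MX MY X Y \<kappa>"
    using assms by (rule joint_abs_cont_kernel)
  have "absolutely_continuous PX (\<kappa> y)" if "y \<in> space MY" for y
    using that f unfolding \<kappa>(1)
    by (intro absolutely_continuousI_density measurable_compose[OF _ f]) auto
  with \<kappa>(2) show ?thesis unfolding conditional_abs_cont_def by blast
qed

text \<open>
  The measure \<open>P\<^sub>X\<close> itself is the dominating one, with constant marginal density 1.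
\<close>

lemma conditional_abs_cont_marginal_if_conditional_abs_cont:
  assumes "conditional_abs_cont M MX MY X Y"
  shows "conditional_abs_cont_marginal M MX MY X Y"
proof -
  have "distributed M PX X (\<lambda>_. 1)"
    by (auto simp: distributed_def density_1 intro!: distr_cong)
  with assms show ?thesis
    unfolding conditional_abs_cont_def conditional_abs_cont_marginal_def
    by (metis sets_distr)
qed

section \<open>From kernels and densities back to absolute continuity\<close>

lemma law_of_total_probability:
  assumes "conditional_distribution M MX MY X Y \<kappa>" "A \<in> sets MX"
  shows "emeasure PX A = (\<integral>\<^sup>+y. emeasure (\<kappa> y) A \<partial>PY)"
proof -
  have "emeasure PX A = transition_product \<kappa> PY (A \<times> space MY)"
    using assms by (simp add: conditional_distribution_def flip: marginal_fst)
  also have "\<dots> = (\<integral>\<^sup>+y. emeasure (\<kappa> y) A \<partial>PY)"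
    unfolding transition_product_def by (intro nn_integral_cong) simp
  finally show ?thesis .
qed

text \<open>
  Averaging the conditional density over \<open>y\<close> gives a marginal density with respect to the same
  \<open>\<mu>\<close>. Its \<open>\<sigma>\<close>-finiteness is what allows the interchange of the two integrals.
\<close>

lemma conditional_abs_cont_marginal_if_has_conditional_density:
  assumes "has_conditional_density M MX MY X Y"
  shows "conditional_abs_cont_marginal M MX MY X Y"
proof -
  obtain \<mu> p \<kappa> where "sigma_finite_measure \<mu>" and \<mu> [measurable_cong]: "sets \<mu> = sets MX"
    and p: "(\<lambda>(x, y). p x y) \<in> borel_measurable (MX \<Otimes>\<^sub>M MY)"
    and \<kappa>: "conditional_distribution M MX MY X Y \<kappa>"
    and \<kappa>p: "\<And>S y. S \<in> sets MX \<Longrightarrow> y \<in> space MY \<Longrightarrow> emeasure (\<kappa> y) S = (\<integral>\<^sup>+x\<in>S. p x y \<partial>\<mu>)"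
    using assms unfolding has_conditional_density_def conditional_density_def by blast
  interpret \<mu>: sigma_finite_measure \<mu> by fact
  interpret \<mu>Y: pair_sigma_finite \<mu> PY ..
  have [measurable]: "(\<lambda>(x, y). p x y) \<in> borel_measurable (\<mu> \<Otimes>\<^sub>M PY)" using p by simp
  define q where "q x = (\<integral>\<^sup>+y. p x y \<partial>PY)" for x
  have q: "q \<in> borel_measurable \<mu>" unfolding q_def by measurable
  have "distr M \<mu> X = density \<mu> q"
  proof (rule measure_eqI)
    fix S assume "S \<in> sets (distr M \<mu> X)"
    then have S [measurable]: "S \<in> sets \<mu>" "S \<in> sets MX" by (simp_all add: \<mu>)
    have "emeasure (distr M \<mu> X) S = emeasure PX S"
      by (intro arg_cong2[where f = emeasure] distr_cong) (simp_all add: \<mu>)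
    also have "\<dots> = (\<integral>\<^sup>+y. \<integral>\<^sup>+x. p x y * indicator S x \<partial>\<mu> \<partial>PY)"
      using S by (simp add: law_of_total_probability[OF \<kappa>] \<kappa>p cong: nn_integral_cong_simp)
    also have "\<dots> = (\<integral>\<^sup>+x. \<integral>\<^sup>+y. p x y * indicator S x \<partial>PY \<partial>\<mu>)"
      by (rule \<mu>Y.Fubini') measurable
    also have "\<dots> = (\<integral>\<^sup>+x. q x * indicator S x \<partial>\<mu>)"
      unfolding q_def by (intro nn_integral_cong nn_integral_multc) simp
    finally show "emeasure (distr M \<mu> X) S = emeasure (density \<mu> q) S"
      using q by (simp add: emeasure_density)
  qed simp
  then have "distributed M \<mu> X q" using q by (simp add: distributed_def)
  moreover have "absolutely_continuous \<mu> (\<kappa> y)" if y: "y \<in> space MY" for y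
    unfolding absolutely_continuous_def
  proof
    fix S assume S: "S \<in> null_sets \<mu>"
    then have "emeasure (\<kappa> y) S = 0"
      using y by (subst \<kappa>p) (auto simp: \<mu> intro!: nn_integral_null_set)
    then show "S \<in> null_sets (\<kappa> y)"
      using S y \<kappa> by (auto simp: null_sets_def \<mu> conditional_distribution_def transition_measure_def)
  qed
  ultimately show ?thesis
    unfolding conditional_abs_cont_marginal_def using \<kappa> \<mu> by blast
qed

text \<open>
  Domination by \<open>\<mu>\<close> only controls the kernel where the marginal density \<open>p\<close> is positive: there
  \<open>P\<^sub>X\<close>-null sets are \<open>\<mu>\<close>-null. The rest, \<open>Z = {p = 0}\<close>, is \<open>P\<^sub>X\<close>-null, hence null for almost every
  member of the kernel by the law of total probability. The argument works one section at a time,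
  because Fubini's theorem for \<open>\<mu>\<close> and \<open>P\<^sub>Y\<close> fails in general.
\<close>

lemma joint_abs_cont_if_conditional_abs_cont_marginal:
  assumes "conditional_abs_cont_marginal M MX MY X Y"
  shows "joint_abs_cont M MX MY X Y"
  unfolding joint_abs_cont_iff absolutely_continuous_def
proof
  obtain \<kappa> \<mu> p where \<kappa>: "conditional_distribution M MX MY X Y \<kappa>"
    and \<mu>: "sets \<mu> = sets MX" and d: "distributed M \<mu> X p"
    and ac: "\<And>y. y \<in> space MY \<Longrightarrow> absolutely_continuous \<mu> (\<kappa> y)"
    using assms unfolding conditional_abs_cont_marginal_def by blast
  have p [measurable]: "p \<in> borel_measurable \<mu>" using d by (simp add: distributed_def)
  have "distr M \<mu> X = PX" by (intro distr_cong) (simp_all add: \<mu>)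
  with d have PX: "PX = density \<mu> p" by (simp add: distributed_def)
  define Z where "Z = {x \<in> space \<mu>. p x = 0}"
  have Z\<mu>: "Z \<in> sets \<mu>" unfolding Z_def by measurable
  then have Z: "Z \<in> sets MX" by (simp add: \<mu>)
  have "Z \<in> null_sets PX"
    unfolding PX null_sets_density_iff[OF p] using Z\<mu> by (auto simp: Z_def)
  then have "(\<integral>\<^sup>+y. emeasure (\<kappa> y) Z \<partial>PY) = 0"
    using law_of_total_probability[OF \<kappa> Z] by auto
  moreover have "(\<lambda>y. emeasure (\<kappa> y) Z) \<in> borel_measurable PY"
    using \<kappa> Z by (simp add: conditional_distribution_def transition_measure_def)
  ultimately have AE_Z: "AE y in PY. emeasure (\<kappa> y) Z = 0"
    by (simp add: nn_integral_0_iff_AE)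
  fix S assume S: "S \<in> null_sets (PX \<Otimes>\<^sub>M PY)"
  then have S': "S \<in> sets (PX \<Otimes>\<^sub>M PY)" "S \<in> sets (MX \<Otimes>\<^sub>M MY)"
    using sets_PX_PY by auto
  have S_y: "{x. (x, y) \<in> S} \<in> sets MX" for y
    using sets_Pair2[OF S'(2), of y] by (simp add: vimage_def)
  have "(\<integral>\<^sup>+y. emeasure PX ((\<lambda>x. (x, y)) -` S) \<partial>PY) = 0"
    using S S'(1) by (simp flip: PXPY.emeasure_pair_measure_alt2 add: null_sets_def)
  then have "AE y in PY. emeasure PX {x. (x, y) \<in> S} = 0"
    using PXPY.measurable_emeasure_Pair2[OF S'(1)] by (simp add: nn_integral_0_iff_AE vimage_def)
  with AE_Z AE_space have "AE y in PY. emeasure (\<kappa> y) {x. (x, y) \<in> S} = 0"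
  proof eventually_elim
    fix y assume Z0: "emeasure (\<kappa> y) Z = 0" and "y \<in> space PY" and S0: "emeasure PX {x. (x, y) \<in> S} = 0"
    then have y: "y \<in> space MY" by simp
    have [simp]: "sets (\<kappa> y) = sets MX"
      using y \<kappa> by (simp add: conditional_distribution_def transition_measure_def)
    have "{x. (x, y) \<in> S} \<in> null_sets PX" using S0 S_y by (simp add: null_sets_def)
    then have "AE x in \<mu>. (x, y) \<in> S \<longrightarrow> p x = 0"
      unfolding PX null_sets_density_iff[OF p] by simp
    then have "AE x in \<mu>. x \<notin> {x. (x, y) \<in> S} - Z"
      using AE_space by eventually_elim (simp add: Z_def)
    then have "{x. (x, y) \<in> S} - Z \<in> null_sets \<mu>"
      using S_y Z\<mu> by (subst AE_iff_null_sets) (auto simp: \<mu>)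
    then have "{x. (x, y) \<in> S} - Z \<in> null_sets (\<kappa> y)"
      using ac[OF y] by (auto simp: absolutely_continuous_def)
    moreover have "Z \<in> null_sets (\<kappa> y)" using Z0 Z by (simp add: null_sets_def)
    ultimately have "({x. (x, y) \<in> S} - Z) \<union> Z \<in> null_sets (\<kappa> y)" by (rule null_sets.Un)
    then have "{x. (x, y) \<in> S} \<in> null_sets (\<kappa> y)"
      by (rule null_sets_subset) (use S_y in auto)
    then show "emeasure (\<kappa> y) {x. (x, y) \<in> S} = 0" by blast
  qed
  \<comment> \<open>the integrand is known to be measurable only up to a null set\<close>
  then have "transition_product \<kappa> PY S = 0"
    unfolding transition_product_def by (subst nn_integral_cong_AE[where v = "\<lambda>_. 0"]) auto
  then show "S \<in> null_sets PXY"
    using \<kappa> S'(2) by (simp add: null_sets_def conditional_distribution_def)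
qed

text \<open>
  The product of the marginals has density \<open>q(x) r(y)\<close> with respect to \<open>m \<otimes> n\<close>, where \<open>q\<close> and \<open>r\<close> are
  the integrals of the joint density \<open>f\<close>. The sets \<open>{q = 0}\<close> and \<open>{r = 0}\<close> are null for the
  marginals, so their cylinders are null for the joint law, whence \<open>f\<close> vanishes almost everywhere
  on them: \<open>f\<close> is supported where \<open>q(x) r(y)\<close> is positive.
\<close>

lemma joint_abs_cont_if_sigma_finite:
  assumes "sigma_finite_measure m" "sigma_finite_measure n"
    and m: "sets m = sets MX" and n: "sets n = sets MY"
    and ac: "absolutely_continuous (m \<Otimes>\<^sub>M n) PXY"
  shows "joint_abs_cont M MX MY X Y"
proof -
  interpret m: sigma_finite_measure m by fact
  interpret n: sigma_finite_measure n by fact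
  interpret mn: pair_sigma_finite m n ..
  have sets_mn: "sets (m \<Otimes>\<^sub>M n) = sets (MX \<Otimes>\<^sub>M MY)"
    by (intro sets_pair_measure_cong m n)
  have sp: "space m = space MX" "space n = space MY"
    using sets_eq_imp_space_eq[OF m] sets_eq_imp_space_eq[OF n] .
  obtain f where f [measurable]: "f \<in> borel_measurable (m \<Otimes>\<^sub>M n)" and d: "density (m \<Otimes>\<^sub>M n) f = PXY"
    using mn.Radon_Nikodym[OF ac] sets_mn by auto
  define q where "q x = (\<integral>\<^sup>+y. f (x, y) \<partial>n)" for x
  define r where "r y = (\<integral>\<^sup>+x. f (x, y) \<partial>m)" for y
  have q [measurable]: "q \<in> borel_measurable m" unfolding q_def by measurable
  have r [measurable]: "r \<in> borel_measurable n" unfolding r_def by measurable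
  have PX: "PX = density m q"
  proof (rule measure_eqI)
    fix A assume "A \<in> sets PX"
    then have A: "A \<in> sets MX" and [measurable]: "A \<in> sets m" by (simp_all add: m)
    have "emeasure PX A = emeasure (density (m \<Otimes>\<^sub>M n) f) (A \<times> space n)"
      using A by (simp add: d sp marginal_fst)
    also have "\<dots> = (\<integral>\<^sup>+z. f z * indicator (A \<times> space n) z \<partial>(m \<Otimes>\<^sub>M n))"
      by (intro emeasure_density) measurable
    also have "\<dots> = (\<integral>\<^sup>+x. \<integral>\<^sup>+y. f (x, y) * indicator (A \<times> space n) (x, y) \<partial>n \<partial>m)"
      by (intro n.nn_integral_fst[symmetric]) measurable
    also have "\<dots> = (\<integral>\<^sup>+x. q x * indicator A x \<partial>m)"
      unfolding q_def
      by (intro nn_integral_cong, subst nn_integral_multc[symmetric])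
        (auto simp: indicator_def intro!: nn_integral_cong)
    finally show "emeasure PX A = emeasure (density m q) A" by (simp add: emeasure_density)
  qed (simp add: m)
  have PY: "PY = density n r"
  proof (rule measure_eqI)
    fix B assume "B \<in> sets PY"
    then have B: "B \<in> sets MY" and [measurable]: "B \<in> sets n" by (simp_all add: n)
    have "emeasure PY B = emeasure (density (m \<Otimes>\<^sub>M n) f) (space m \<times> B)"
      using B by (simp add: d sp marginal_snd)
    also have "\<dots> = (\<integral>\<^sup>+z. f z * indicator (space m \<times> B) z \<partial>(m \<Otimes>\<^sub>M n))"
      by (intro emeasure_density) measurable
    also have "\<dots> = (\<integral>\<^sup>+y. \<integral>\<^sup>+x. f (x, y) * indicator (space m \<times> B) (x, y) \<partial>m \<partial>n)"
      by (intro mn.nn_integral_snd[symmetric]) measurable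
    also have "\<dots> = (\<integral>\<^sup>+y. r y * indicator B y \<partial>n)"
      unfolding r_def
      by (intro nn_integral_cong, subst nn_integral_multc[symmetric])
        (auto simp: indicator_def intro!: nn_integral_cong)
    finally show "emeasure PY B = emeasure (density n r) B" by (simp add: emeasure_density)
  qed (simp add: n)
  have PXPY: "PX \<Otimes>\<^sub>M PY = density (m \<Otimes>\<^sub>M n) (\<lambda>(x, y). q x * r y)"
    using PY.sigma_finite_measure_axioms unfolding PX PY
    by (intro pair_measure_density) (simp_all add: n.sigma_finite_measure_axioms)
  define Q where "Q = {x \<in> space m. q x = 0}"
  define R where "R = {y \<in> space n. r y = 0}"
  have Qm [measurable]: "Q \<in> sets m" and Rn [measurable]: "R \<in> sets n"
    unfolding Q_def R_def by measurable
  have "Q \<in> null_sets PX" "R \<in> null_sets PY"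
    unfolding PX PY null_sets_density_iff[OF q] null_sets_density_iff[OF r]
    using Qm Rn by (auto simp: Q_def R_def)
  then have "Q \<times> space MY \<in> null_sets PXY" "space MX \<times> R \<in> null_sets PXY"
    using Qm Rn by (auto simp: null_sets_def marginal_fst marginal_snd m n simp del: sets_distr)
  then have "AE z in m \<Otimes>\<^sub>M n. z \<in> Q \<times> space MY \<longrightarrow> f z = 0"
    "AE z in m \<Otimes>\<^sub>M n. z \<in> space MX \<times> R \<longrightarrow> f z = 0"
    unfolding d[symmetric] null_sets_density_iff[OF f] by auto
  then have off: "AE z in m \<Otimes>\<^sub>M n. q (fst z) * r (snd z) = 0 \<longrightarrow> f z = 0"
    using AE_space by eventually_elim (auto simp: Q_def R_def sp space_pair_measure)
  have qr: "(\<lambda>(x, y). q x * r y) \<in> borel_measurable (m \<Otimes>\<^sub>M n)" by measurable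
  show ?thesis
    unfolding joint_abs_cont_iff absolutely_continuous_def PXPY d[symmetric]
  proof
    fix S assume "S \<in> null_sets (density (m \<Otimes>\<^sub>M n) (\<lambda>(x, y). q x * r y))"
    then have "S \<in> sets (m \<Otimes>\<^sub>M n)" "AE z in m \<Otimes>\<^sub>M n. z \<in> S \<longrightarrow> q (fst z) * r (snd z) = 0"
      unfolding null_sets_density_iff[OF qr] by (auto simp: split_beta)
    with off show "S \<in> null_sets (density (m \<Otimes>\<^sub>M n) f)"
      unfolding null_sets_density_iff[OF f] by (auto elim: AE_mp)
  qed
qed

text \<open>
  Reduction to the \<open>\<sigma>\<close>-finite case. The joint law is carried by countably many rectangles
  \<open>C \<times> D\<close> with \<open>\<mu>(C) \<nu>(D) < \<infinity>\<close>. Those with a side of infinite measure are null because of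
  \<open>0 \<cdot> \<infinity> = 0\<close>; on the union of the first sides, and of the second sides, of the remaining ones,
  \<open>\<mu>\<close> and \<open>\<nu>\<close> are \<open>\<sigma>\<close>-finite. It suffices to see that the joint law is absolutely continuous with
  respect to the product of these restrictions, which only requires comparing null sets.
\<close>

lemma joint_abs_cont_if_has_joint_density:
  assumes "has_joint_density M MX MY X Y"
  shows "joint_abs_cont M MX MY X Y"
proof -
  obtain \<mu> \<nu> p where \<mu>: "sets \<mu> = sets MX" and \<nu>: "sets \<nu> = sets MY"
    and dist: "distributed M (\<mu> \<times>\<^sub>M \<nu>) (\<lambda>\<omega>. (X \<omega>, Y \<omega>)) p"
    using assms unfolding has_joint_density_def by blast
  have p: "p \<in> borel_measurable (\<mu> \<times>\<^sub>M \<nu>)" using dist by (simp add: distributed_def)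
  have sets_\<mu>\<nu>: "sets (\<mu> \<Otimes>\<^sub>M \<nu>) = sets (MX \<Otimes>\<^sub>M MY)"
    by (intro sets_pair_measure_cong \<mu> \<nu>)
  have "distr M (\<mu> \<times>\<^sub>M \<nu>) (\<lambda>\<omega>. (X \<omega>, Y \<omega>)) = PXY"
    by (intro distr_cong) (simp_all add: sets_\<mu>\<nu>)
  with dist have d: "density (\<mu> \<times>\<^sub>M \<nu>) p = PXY" by (simp add: distributed_def)
  have null: "S \<in> null_sets PXY"
    if "S \<in> sets (\<mu> \<Otimes>\<^sub>M \<nu>)" "rectangle_outer \<mu> \<nu> S = 0" for S
    using that absolutely_continuousI_density[OF p]
    by (auto simp: absolutely_continuous_def null_sets_def emeasure_prod_measure d)
  obtain E :: "nat \<Rightarrow> _" where E: "range E \<subseteq> sets (\<mu> \<times>\<^sub>M \<nu>)" "\<And>n. emeasure (\<mu> \<times>\<^sub>M \<nu>) (E n) < \<infinity>"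
    and E0: "space (\<mu> \<times>\<^sub>M \<nu>) - (\<Union>n. E n) \<in> null_sets PXY"
    using finite_density_carrier[OF p] unfolding d by (auto simp: PXY.emeasure_eq_measure)
  define cover where "cover n C D \<longleftrightarrow> range C \<subseteq> sets \<mu> \<and> range D \<subseteq> sets \<nu> \<and>
      E n \<subseteq> (\<Union>k::nat. C k \<times> D k) \<and> (\<Sum>k. emeasure \<mu> (C k) * emeasure \<nu> (D k)) < \<infinity>" for n C D
  have "\<exists>C D. cover n C D" for n
  proof -
    have "rectangle_outer \<mu> \<nu> (E n) < \<infinity>"
      using E(1) E(2)[of n] by (auto simp flip: emeasure_prod_measure)
    then show ?thesis unfolding cover_def by (rule rectangle_outer_close) blast
  qed
  then obtain C D where "\<And>n. cover n (C n) (D n)" by metis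
  then have CD: "\<And>n. range (C n) \<subseteq> sets \<mu>" "\<And>n. range (D n) \<subseteq> sets \<nu>"
      "\<And>n. E n \<subseteq> (\<Union>k::nat. C n k \<times> D n k)"
      "\<And>n. (\<Sum>k. emeasure \<mu> (C n k) * emeasure \<nu> (D n k)) < \<infinity>"
    unfolding cover_def by blast+
  have lt: "emeasure \<mu> (C n k) * emeasure \<nu> (D n k) < \<infinity>" for n k
    using ennreal_suminf_lessD[OF CD(4)] by simp
  \<comment> \<open>the rectangles with both sides finite, for which alone the sides contribute to \<open>\<A>\<close> and \<open>\<B>\<close>\<close>
  define I where "I = {(n, k). emeasure \<mu> (C n k) < \<infinity> \<and> emeasure \<nu> (D n k) < \<infinity>}"
  define \<A> where "\<A> = (\<lambda>(n, k). C n k) ` I"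
  define \<B> where "\<B> = (\<lambda>(n, k). D n k) ` I"
  have \<A>: "countable \<A>" "\<A> \<subseteq> sets \<mu>" "\<And>a. a \<in> \<A> \<Longrightarrow> emeasure \<mu> a < \<infinity>"
    and \<B>: "countable \<B>" "\<B> \<subseteq> sets \<nu>" "\<And>b. b \<in> \<B> \<Longrightarrow> emeasure \<nu> b < \<infinity>"
    using CD(1,2) by (auto simp: \<A>_def \<B>_def I_def)
  have U\<A>: "\<Union>\<A> \<in> sets \<mu>" and U\<B>: "\<Union>\<B> \<in> sets \<nu>"
    using \<A> \<B> by (auto intro: sets.countable_Union)
  define m where "m = density \<mu> (indicator (\<Union>\<A>))"
  define n where "n = density \<nu> (indicator (\<Union>\<B>))"
  have "sigma_finite_measure m" "sigma_finite_measure n"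
    unfolding m_def n_def using \<A> \<B> by (auto intro!: sigma_finite_density_indicator)
  moreover have "sets m = sets MX" "sets n = sets MY"
    by (simp_all add: m_def n_def \<mu> \<nu>)
  moreover have "absolutely_continuous (m \<Otimes>\<^sub>M n) PXY"
    unfolding absolutely_continuous_def
  proof
    fix S assume S: "S \<in> null_sets (m \<Otimes>\<^sub>M n)"
    have mn: "m \<times>\<^sub>M n = m \<Otimes>\<^sub>M n" by (intro prod_measure_eq_pair_measure) fact+
    have sets_mn: "sets (m \<Otimes>\<^sub>M n) = sets (\<mu> \<Otimes>\<^sub>M \<nu>)"
      by (intro sets_pair_measure_cong) (simp_all add: m_def n_def)
    have S': "S \<in> sets (\<mu> \<Otimes>\<^sub>M \<nu>)" using S sets_mn by auto
    have "rectangle_outer m n S = emeasure (m \<Otimes>\<^sub>M n) S"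
      unfolding mn[symmetric] using S' sets_mn by (intro emeasure_prod_measure[symmetric]) simp
    then have "rectangle_outer \<mu> \<nu> (S \<inter> \<Union>\<A> \<times> \<Union>\<B>) = 0"
      using rectangle_outer_restrict_le[OF U\<A> U\<B>, of S] S by (auto simp: m_def n_def)
    then have on: "S \<inter> \<Union>\<A> \<times> \<Union>\<B> \<in> null_sets PXY"
      using S' U\<A> U\<B> by (intro null) auto
    have bad: "C i k \<times> D i k \<in> null_sets PXY" if "(i, k) \<notin> I" for i k
    proof (rule null)
      have CDs: "C i k \<in> sets \<mu>" "D i k \<in> sets \<nu>" using CD(1,2) by auto
      then show "C i k \<times> D i k \<in> sets (\<mu> \<Otimes>\<^sub>M \<nu>)" by simp
      \<comment> \<open>a finite product with an infinite factor is zero\<close>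
      have "emeasure \<mu> (C i k) * emeasure \<nu> (D i k) = 0"
        using lt[of i k] that by (auto simp: I_def ennreal_mult_less_top less_top)
      then show "rectangle_outer \<mu> \<nu> (C i k \<times> D i k) = 0"
        using CDs by (simp add: rectangle_outer_times)
    qed
    have "(\<Union>(i, k)\<in>-I. C i k \<times> D i k) \<in> null_sets PXY"
      using bad by (intro null_sets_UN') auto
    then have N: "(S \<inter> \<Union>\<A> \<times> \<Union>\<B>) \<union> ((space (\<mu> \<times>\<^sub>M \<nu>) - (\<Union>n. E n)) \<union> (\<Union>(i, k)\<in>-I. C i k \<times> D i k)) \<in> null_sets PXY"
      using on E0 by (intro null_sets.Un)
    have "S \<subseteq> (S \<inter> \<Union>\<A> \<times> \<Union>\<B>) \<union> ((space (\<mu> \<times>\<^sub>M \<nu>) - (\<Union>n. E n)) \<union> (\<Union>(i, k)\<in>-I. C i k \<times> D i k))"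
    proof
      fix z assume z: "z \<in> S"
      then have sp: "z \<in> space (\<mu> \<times>\<^sub>M \<nu>)"
        using sets.sets_into_space[OF S'] by (auto simp: space_pair_measure)
      show "z \<in> (S \<inter> \<Union>\<A> \<times> \<Union>\<B>) \<union> ((space (\<mu> \<times>\<^sub>M \<nu>) - (\<Union>n. E n)) \<union> (\<Union>(i, k)\<in>-I. C i k \<times> D i k))"
      proof (cases "z \<in> (\<Union>n. E n)")
        case True
        then obtain i k where ik: "z \<in> C i k \<times> D i k" using CD(3) by blast
        show ?thesis
        proof (cases "(i, k) \<in> I")
          case True
          then have "C i k \<in> \<A>" "D i k \<in> \<B>" by (force simp: \<A>_def \<B>_def)+
          with ik z show ?thesis by blast
        qed (use ik in blast)
      qed (use sp in blast)
    qed
    then show "S \<in> null_sets PXY"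
      using N S' by (intro null_sets_subset[OF N]) (simp_all add: sets_\<mu>\<nu>)
  qed
  ultimately show ?thesis by (rule joint_abs_cont_if_sigma_finite)
qed

section \<open>The equivalence, images and exchange of the variables\<close>

lemma equivalent_conditions:
  "has_joint_density M MX MY X Y \<longleftrightarrow> joint_abs_cont M MX MY X Y"
  "has_conditional_density M MX MY X Y \<longleftrightarrow> joint_abs_cont M MX MY X Y"
  "conditional_abs_cont M MX MY X Y \<longleftrightarrow> joint_abs_cont M MX MY X Y"
  "conditional_abs_cont_marginal M MX MY X Y \<longleftrightarrow> joint_abs_cont M MX MY X Y"
  using has_joint_density_if_joint_abs_cont has_conditional_density_if_joint_abs_cont
    conditional_abs_cont_if_joint_abs_cont conditional_abs_cont_marginal_if_conditional_abs_cont
    conditional_abs_cont_marginal_if_has_conditional_density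
    joint_abs_cont_if_conditional_abs_cont_marginal joint_abs_cont_if_has_joint_density
  by blast+

lemma joint_abs_cont_image:
  assumes F [measurable]: "F \<in> measurable MX MX'" and G [measurable]: "G \<in> measurable MY MY'"
    and "joint_abs_cont M MX MY X Y"
  shows "joint_abs_cont M MX' MY' (F \<circ> X) (G \<circ> Y)"
proof -
  interpret I: random_pair M MX' MY' "F \<circ> X" "G \<circ> Y" by unfold_locales measurable
  let ?FG = "\<lambda>(x, y). (F x, G y)"
  have "I.PX = distr PX MX' F" "I.PY = distr PY MY' G"
    by (simp_all add: distr_distr)
  then have "I.PX \<Otimes>\<^sub>M I.PY = distr PX MX' F \<Otimes>\<^sub>M distr PY MY' G" by simp
  also have "\<dots> = distr (PX \<Otimes>\<^sub>M PY) (MX' \<Otimes>\<^sub>M MY') ?FG"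
    using I.PY.sigma_finite_measure_axioms by (intro pair_measure_distr) (simp_all add: distr_distr)
  finally have prod: "I.PX \<Otimes>\<^sub>M I.PY = distr (PX \<Otimes>\<^sub>M PY) (MX' \<Otimes>\<^sub>M MY') ?FG" .
  have joint: "I.PXY = distr PXY (MX' \<Otimes>\<^sub>M MY') ?FG"
    by (subst distr_distr) (auto simp: comp_def)
  show ?thesis
    using assms(3) unfolding I.joint_abs_cont_iff joint_abs_cont_iff absolutely_continuous_def prod joint
    by (auto simp: null_sets_distr_iff space_pair_measure)
qed

lemma joint_abs_cont_swap:
  assumes "joint_abs_cont M MX MY X Y"
  shows "joint_abs_cont M MY MX Y X"
proof -
  interpret S: random_pair M MY MX Y X by unfold_locales measurable
  let ?swap = "\<lambda>(x, y). (y, x)"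
  have prod: "S.PX \<Otimes>\<^sub>M S.PY = distr (PX \<Otimes>\<^sub>M PY) (MY \<Otimes>\<^sub>M MX) ?swap"
    using S.PXPY.distr_pair_swap by (simp cong: distr_cong)
  have joint: "S.PXY = distr PXY (MY \<Otimes>\<^sub>M MX) ?swap"
    by (subst distr_distr) (auto simp: comp_def)
  show ?thesis
    using assms unfolding S.joint_abs_cont_iff joint_abs_cont_iff absolutely_continuous_def prod joint
    by (auto simp: null_sets_distr_iff space_pair_measure)
qed

end

theorem theorem1:
  fixes M :: "'w measure" and MX :: "'x measure" and MY :: "'y measure"
    and X :: "'w \<Rightarrow> 'x" and Y :: "'w \<Rightarrow> 'y"
  assumes "prob_space M"
    and "X \<in> measurable M MX" and "Y \<in> measurable M MY"
  shows "((has_joint_density M MX MY X Y \<longleftrightarrow> joint_abs_cont M MX MY X Y) \<and>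
          (has_conditional_density M MX MY X Y \<longleftrightarrow> joint_abs_cont M MX MY X Y) \<and>
          (conditional_abs_cont M MX MY X Y \<longleftrightarrow> joint_abs_cont M MX MY X Y) \<and>
          (conditional_abs_cont_marginal M MX MY X Y \<longleftrightarrow> joint_abs_cont M MX MY X Y)) \<and>
         ((has_joint_density M MY MX Y X \<longleftrightarrow> joint_abs_cont M MX MY X Y) \<and>
          (joint_abs_cont M MY MX Y X \<longleftrightarrow> joint_abs_cont M MX MY X Y) \<and>
          (has_conditional_density M MY MX Y X \<longleftrightarrow> joint_abs_cont M MX MY X Y) \<and>
          (conditional_abs_cont M MY MX Y X \<longleftrightarrow> joint_abs_cont M MX MY X Y) \<and>
          (conditional_abs_cont_marginal M MY MX Y X \<longleftrightarrow> joint_abs_cont M MX MY X Y)) \<and>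
         (\<forall>(MX' :: 'x2 measure) (MY' :: 'y2 measure) F G.
            F \<in> measurable MX MX' \<longrightarrow> G \<in> measurable MY MY' \<longrightarrow> joint_abs_cont M MX MY X Y \<longrightarrow>
              has_joint_density M MX' MY' (F \<circ> X) (G \<circ> Y) \<and>
              joint_abs_cont M MX' MY' (F \<circ> X) (G \<circ> Y) \<and>
              has_conditional_density M MX' MY' (F \<circ> X) (G \<circ> Y) \<and>
              conditional_abs_cont M MX' MY' (F \<circ> X) (G \<circ> Y) \<and>
              conditional_abs_cont_marginal M MX' MY' (F \<circ> X) (G \<circ> Y))"
proof -
  interpret XY: random_pair M MX MY X Y by (intro random_pair.intro random_pair_axioms.intro assms)
  interpret YX: random_pair M MY MX Y X by (intro random_pair.intro random_pair_axioms.intro assms)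
  have swap: "joint_abs_cont M MY MX Y X \<longleftrightarrow> joint_abs_cont M MX MY X Y"
    using XY.joint_abs_cont_swap YX.joint_abs_cont_swap by blast
  have image: "has_joint_density M MX' MY' (F \<circ> X) (G \<circ> Y) \<and>
      joint_abs_cont M MX' MY' (F \<circ> X) (G \<circ> Y) \<and>
      has_conditional_density M MX' MY' (F \<circ> X) (G \<circ> Y) \<and>
      conditional_abs_cont M MX' MY' (F \<circ> X) (G \<circ> Y) \<and>
      conditional_abs_cont_marginal M MX' MY' (F \<circ> X) (G \<circ> Y)"
    if F: "F \<in> measurable MX MX'" and G: "G \<in> measurable MY MY'" and "joint_abs_cont M MX MY X Y"
    for MX' :: "'x2 measure" and MY' :: "'y2 measure" and F G
  proof -
    interpret FG: random_pair M MX' MY' "F \<circ> X" "G \<circ> Y"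
      by (intro random_pair.intro random_pair_axioms.intro assms measurable_comp[OF _ F] measurable_comp[OF _ G])
    show ?thesis using XY.joint_abs_cont_image[OF that] by (simp add: FG.equivalent_conditions)
  qed
  show ?thesis
    using image by (simp add: XY.equivalent_conditions YX.equivalent_conditions swap)
qed

end
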